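(* Let $(A,\cdot_A,\mathfrak B,P)$ be a quadratic Rota-Baxter perm algebra of weight $\lambda\neq0$. Let $r\in A\otimes A$ be the 2-tensor determined by $$T_r(a^* )=P((\mathfrak B^\sharp)^{-1}(a^* )),\quad\forall a^*\in A^*.$$ Then $(A,\cdot_A,\Delta_r)$ is a factorizable perm bialgebra, where $\Delta_r(a)=(\mathrm{id}\otimes R(a)-\mathrm{ad}(a)\otimes\mathrm{id})(r)$ for all $a\in A$.
   Context: Conventions: the base field $\mathbb K$ has characteristic zero; all vector spaces and algebras are finite-dimensional. For a bilinear operation $\cdot_A$ on $A$: $L(a)b=a\cdot_A b$, $R(a)b=b\cdot_A a$, $\mathrm{ad}(a)=L(a)-R(a)$. $\sigma(u\otimes v)=v\otimes u$. Perm algebra: a vector space $A$ with bilinear $\cdot_A$ such that $a\cdot_A(b\cdot_A c)=(a\cdot_A b)\cdot_A c=(b\cdot_A a)\cdot_A c$ for all $a,b,c\in A$. Perm coalgebra: $(A,\Delta)$ with $\Delta:A\to A\otimes A$ linear and $(\Delta\otimes\mathrm{id})\Delta=(\mathrm{id}\otimes\Delta)\Delta=(\sigma\otimes\mathrm{id})(\Delta\otimes\mathrm{id})\Delta$. Perm bialgebra: $(A,\cdot_A,\Delta)$ with $(A,\cdot_A)$ a perm algebra, $(A,\Delta)$ a perm coalgebra, and for all $a,b\in A$: $\Delta(a\cdot_A b)=(\mathrm{ad}(a)\otimes\mathrm{id})\Delta(b)+(\mathrm{id}\otimes R(b))\Delta(a)$; $\sigma(R(b)\otimes\mathrm{id})\Delta(a)=(R(a)\otimes\mathrm{id})\Delta(b)$;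 $\Delta(a\cdot_A b)=(\mathrm{id}\otimes L(a))\Delta(b)+(\mathrm{ad}(b)\otimes\mathrm{id})(\Delta(a)-\sigma\Delta(a))$. For $r=\sum_i a_i\otimes b_i\in A\otimes A$: $T_r:A^*\to A$, $T_r(a^* )=\sum_i\langle a^*,a_i\rangle b_i$ (this identifies $A\otimes A$ with $\mathrm{Hom}(A^*,A)$). $r$ is a solution of the perm Yang-Baxter equation in $(A,\cdot_A)$ if $\sum_{i,j}\big(a_i\otimes b_i\cdot_A a_j\otimes b_j-a_i\otimes a_j\otimes b_i\cdot_A b_j+a_i\cdot_A a_j\otimes b_i\otimes b_j-a_j\cdot_A a_i\otimes b_i\otimes b_j\big)=0$. $s\in A\otimes A$ is $(R,\mathrm{ad})$-invariant if $(\mathrm{id}\otimes R(a)-\mathrm{ad}(a)\otimes\mathrm{id})(s)=0$ for all $a\in A$. Quasi-triangular perm bialgebra: a perm bialgebra $(A,\cdot_A,\Delta_r)$ where $r$ solves the perm Yang-Baxter equation and $\frac12(r-\sigma(r))$ is $(R,\mathrm{ad})$-invariant. It is factorizable if moreover $T_{r-\sigma(r)}:A^*\to A$ is a linear isomorphism. A bilinear form $\mathfrak B$ on a perm algebra is invariant if $\mathfrak B(a\cdot_A b,c)=\mathfrak B(a,b\cdot_A c-c\cdot_A b)$. A quadratic perm algebra $(A,\cdot_A,\mathfrak B)$ is a perm algebra with a nondegenerate skew-symmetric invariant bilinear form; $\mathfrak B^\sharp:A\to A^*$ is $\langle\mathfrak B^\sharp(a),b\rangle=\mathfrak B(a,b)$.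 A Rota-Baxter operator of weight $\lambda$ on $(A,\cdot_A)$ is a linear map $P:A\to A$ with $P(a)\cdot_A P(b)=P(P(a)\cdot_A b+a\cdot_A P(b)+\lambda a\cdot_A b)$. A quadratic Rota-Baxter perm algebra of weight $\lambda$ is $(A,\cdot_A,\mathfrak B,P)$ with $(A,\cdot_A,\mathfrak B)$ a quadratic perm algebra and $P$ a Rota-Baxter operator of weight $\lambda$ such that $\mathfrak B(P(a),b)+\mathfrak B(a,P(b))+\lambda\mathfrak B(a,b)=0$ for all $a,b\in A$. *)

theory Defs
  imports Complex_Main "HOL-Library.Function_Algebras"
begin

text \<open>
  Vector spaces are given by a scalar multiplication \<open>s :: 'k \<Rightarrow> 'a \<Rightarrow> 'a\<close> on the type \<open>'a\<close>.

  Tensors. The tensor product \<open>A \<otimes> A\<close> is realised inside the space of bilinear forms on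
  \<open>A\<^sup>* \<times> A\<^sup>*\<close>, with \<open>a \<otimes> b\<close> being the form \<open>(f, g) \<mapsto> f a * g b\<close>; likewise \<open>A \<otimes> A \<otimes> A\<close> consists of
  trilinear forms. Functions that are not linear functionals are sent to \<open>0\<close>, so that equality of
  tensors is equality of HOL functions. Addition and \<open>0\<close> are pointwise. The facts \<open>pure2_bilinear\<close>
  and \<open>tensor2_universal\<close> (and their analogues for three factors) say that these are tensor
  products.
\<close>

definition dual :: "('k::field \<Rightarrow> 'a::ab_group_add \<Rightarrow> 'a) \<Rightarrow> ('a \<Rightarrow> 'k) set" where
  "dual s = {f. Vector_Spaces.linear s (*) f}"

definition bilinear_map ::
  "('k::field \<Rightarrow> 'a::ab_group_add \<Rightarrow> 'a) \<Rightarrow> ('k \<Rightarrow> 'b::ab_group_add \<Rightarrow> 'b) \<Rightarrow>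
   ('k \<Rightarrow> 'c::ab_group_add \<Rightarrow> 'c) \<Rightarrow> ('a \<Rightarrow> 'b \<Rightarrow> 'c) \<Rightarrow> bool" where
  "bilinear_map s1 s2 s3 h \<longleftrightarrow>
     (\<forall>x. Vector_Spaces.linear s2 s3 (h x)) \<and> (\<forall>y. Vector_Spaces.linear s1 s3 (\<lambda>x. h x y))"

type_synonym ('a, 'k) tensor2 = "('a \<Rightarrow> 'k) \<Rightarrow> ('a \<Rightarrow> 'k) \<Rightarrow> 'k"
type_synonym ('a, 'k) tensor3 = "('a \<Rightarrow> 'k) \<Rightarrow> ('a \<Rightarrow> 'k) \<Rightarrow> ('a \<Rightarrow> 'k) \<Rightarrow> 'k"

definition pure2 :: "('k::field \<Rightarrow> 'a::ab_group_add \<Rightarrow> 'a) \<Rightarrow> 'a \<Rightarrow> 'a \<Rightarrow> ('a, 'k) tensor2" where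
  "pure2 s a b = (\<lambda>f g. if f \<in> dual s \<and> g \<in> dual s then f a * g b else 0)"

definition pure3 ::
  "('k::field \<Rightarrow> 'a::ab_group_add \<Rightarrow> 'a) \<Rightarrow> 'a \<Rightarrow> 'a \<Rightarrow> 'a \<Rightarrow> ('a, 'k) tensor3" where
  "pure3 s a b c =
     (\<lambda>f g h. if f \<in> dual s \<and> g \<in> dual s \<and> h \<in> dual s then f a * g b * h c else 0)"

definition tensor_of ::
  "('k::field \<Rightarrow> 'a::ab_group_add \<Rightarrow> 'a) \<Rightarrow> ('a \<times> 'a) list \<Rightarrow> ('a, 'k) tensor2" where
  "tensor_of s xs = (\<Sum>(a, b)\<leftarrow>xs. pure2 s a b)"

definition tensor3_of ::
  "('k::field \<Rightarrow> 'a::ab_group_add \<Rightarrow> 'a) \<Rightarrow> ('a \<times> 'a \<times> 'a) list \<Rightarrow> ('a, 'k) tensor3" where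
  "tensor3_of s xs = (\<Sum>(a, b, c)\<leftarrow>xs. pure3 s a b c)"

definition tensors2 :: "('k::field \<Rightarrow> 'a::ab_group_add \<Rightarrow> 'a) \<Rightarrow> ('a, 'k) tensor2 set" where
  "tensors2 s = range (tensor_of s)"

definition tscale :: "'k::field \<Rightarrow> ('a, 'k) tensor2 \<Rightarrow> ('a, 'k) tensor2" where
  "tscale c t = (\<lambda>f g. c * t f g)"

definition tscale3 :: "'k::field \<Rightarrow> ('a, 'k) tensor3 \<Rightarrow> ('a, 'k) tensor3" where
  "tscale3 c t = (\<lambda>f g h. c * t f g h)"

text \<open>
  The maps \<open>\<phi> \<otimes> \<psi>\<close> and \<open>\<sigma>\<close> on \<open>A \<otimes> A\<close>, and \<open>\<Delta> \<otimes> id\<close>, \<open>id \<otimes> \<Delta>\<close> and \<open>\<sigma> \<otimes> id\<close> on two- and three-fold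
  tensors; their values on pure tensors are computed below.
\<close>

definition tensor_map ::
  "('k::field \<Rightarrow> 'a::ab_group_add \<Rightarrow> 'a) \<Rightarrow> ('a \<Rightarrow> 'a) \<Rightarrow> ('a \<Rightarrow> 'a) \<Rightarrow>
   ('a, 'k) tensor2 \<Rightarrow> ('a, 'k) tensor2" where
  "tensor_map s \<phi> \<psi> t =
     (\<lambda>f g. if f \<in> dual s \<and> g \<in> dual s then t (f \<circ> \<phi>) (g \<circ> \<psi>) else 0)"

definition tflip :: "('a, 'k) tensor2 \<Rightarrow> ('a, 'k) tensor2" where
  "tflip t = (\<lambda>f g. t g f)"

definition apply_left ::
  "('k::field \<Rightarrow> 'a::ab_group_add \<Rightarrow> 'a) \<Rightarrow> ('a \<Rightarrow> ('a, 'k) tensor2) \<Rightarrow>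
   ('a, 'k) tensor2 \<Rightarrow> ('a, 'k) tensor3" where
  "apply_left s \<Delta> t =
     (\<lambda>f g h. if f \<in> dual s \<and> g \<in> dual s \<and> h \<in> dual s then t (\<lambda>a. \<Delta> a f g) h else 0)"

definition apply_right ::
  "('k::field \<Rightarrow> 'a::ab_group_add \<Rightarrow> 'a) \<Rightarrow> ('a \<Rightarrow> ('a, 'k) tensor2) \<Rightarrow>
   ('a, 'k) tensor2 \<Rightarrow> ('a, 'k) tensor3" where
  "apply_right s \<Delta> t =
     (\<lambda>f g h. if f \<in> dual s \<and> g \<in> dual s \<and> h \<in> dual s then t f (\<lambda>b. \<Delta> b g h) else 0)"

definition tflip12 :: "('a, 'k) tensor3 \<Rightarrow> ('a, 'k) tensor3" where
  "tflip12 t = (\<lambda>f g h. t g f h)"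

text \<open>
  \<open>T\<^sub>r(f)\<close> is the vector \<open>v\<close> with \<open>\<langle>g, v\<rangle> = r(f, g)\<close> for all \<open>g\<close>; see \<open>T_map_tensor_of\<close> for
  \<open>T\<^sub>r(f) = \<Sum>\<^sub>i \<langle>f, a\<^sub>i\<rangle> b\<^sub>i\<close>.
\<close>

definition T_map ::
  "('k::field \<Rightarrow> 'a::ab_group_add \<Rightarrow> 'a) \<Rightarrow> ('a, 'k) tensor2 \<Rightarrow> ('a \<Rightarrow> 'k) \<Rightarrow> 'a" where
  "T_map s r f = (THE v. \<forall>g\<in>dual s. g v = r f g)"

definition dual_linear ::
  "('k::field \<Rightarrow> 'a::ab_group_add \<Rightarrow> 'a) \<Rightarrow> (('a \<Rightarrow> 'k) \<Rightarrow> 'a) \<Rightarrow> bool" where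
  "dual_linear s F \<longleftrightarrow>
     (\<forall>f\<in>dual s. \<forall>g\<in>dual s. F (\<lambda>x. f x + g x) = F f + F g) \<and>
     (\<forall>c. \<forall>f\<in>dual s. F (\<lambda>x. c * f x) = s c (F f))"

definition dual_linear_iso ::
  "('k::field \<Rightarrow> 'a::ab_group_add \<Rightarrow> 'a) \<Rightarrow> (('a \<Rightarrow> 'k) \<Rightarrow> 'a) \<Rightarrow> bool" where
  "dual_linear_iso s F \<longleftrightarrow> dual_linear s F \<and> bij_betw F (dual s) UNIV"

definition left_op :: "('a \<Rightarrow> 'a \<Rightarrow> 'a) \<Rightarrow> 'a \<Rightarrow> 'a \<Rightarrow> 'a" where
  "left_op m a b = m a b"

definition right_op :: "('a \<Rightarrow> 'a \<Rightarrow> 'a) \<Rightarrow> 'a \<Rightarrow> 'a \<Rightarrow> 'a" where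
  "right_op m a b = m b a"

definition ad_op :: "('a \<Rightarrow> 'a \<Rightarrow> 'a::ab_group_add) \<Rightarrow> 'a \<Rightarrow> 'a \<Rightarrow> 'a" where
  "ad_op m a b = left_op m a b - right_op m a b"

definition perm_algebra ::
  "('k::field \<Rightarrow> 'a::ab_group_add \<Rightarrow> 'a) \<Rightarrow> ('a \<Rightarrow> 'a \<Rightarrow> 'a) \<Rightarrow> bool" where
  "perm_algebra s m \<longleftrightarrow>
     bilinear_map s s s m \<and>
     (\<forall>a b c. m a (m b c) = m (m a b) c \<and> m (m a b) c = m (m b a) c)"

definition perm_coalgebra ::
  "('k::field \<Rightarrow> 'a::ab_group_add \<Rightarrow> 'a) \<Rightarrow> ('a \<Rightarrow> ('a, 'k) tensor2) \<Rightarrow> bool" where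
  "perm_coalgebra s \<Delta> \<longleftrightarrow>
     (\<forall>a. \<Delta> a \<in> tensors2 s) \<and>
     Vector_Spaces.linear s tscale \<Delta> \<and>
     (\<forall>a. apply_left s \<Delta> (\<Delta> a) = apply_right s \<Delta> (\<Delta> a) \<and>
          apply_right s \<Delta> (\<Delta> a) = tflip12 (apply_left s \<Delta> (\<Delta> a)))"

definition perm_bialgebra ::
  "('k::field \<Rightarrow> 'a::ab_group_add \<Rightarrow> 'a) \<Rightarrow> ('a \<Rightarrow> 'a \<Rightarrow> 'a) \<Rightarrow>
   ('a \<Rightarrow> ('a, 'k) tensor2) \<Rightarrow> bool" where
  "perm_bialgebra s m \<Delta> \<longleftrightarrow>
     perm_algebra s m \<and> perm_coalgebra s \<Delta> \<and>
     (\<forall>a b. \<Delta> (m a b) =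
        tensor_map s (ad_op m a) id (\<Delta> b) + tensor_map s id (right_op m b) (\<Delta> a)) \<and>
     (\<forall>a b. tflip (tensor_map s (right_op m b) id (\<Delta> a)) =
        tensor_map s (right_op m a) id (\<Delta> b)) \<and>
     (\<forall>a b. \<Delta> (m a b) =
        tensor_map s id (left_op m a) (\<Delta> b)
        + tensor_map s (ad_op m b) id (\<Delta> a - tflip (\<Delta> a)))"

text \<open>
  The left-hand side of the perm Yang-Baxter equation, for the representative
  \<open>xs = [(a\<^sub>1, b\<^sub>1), \<dots>, (a\<^sub>n, b\<^sub>n)]\<close> of \<open>r\<close>; as an element of \<open>A \<otimes> A \<otimes> A\<close> it does not depend on the
  representative (\<open>perm_YB_sum_cong\<close>).
\<close>

definition perm_YB_sum ::
  "('k::field \<Rightarrow> 'a::ab_group_add \<Rightarrow> 'a) \<Rightarrow> ('a \<Rightarrow> 'a \<Rightarrow> 'a) \<Rightarrow>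
   ('a \<times> 'a) list \<Rightarrow> ('a, 'k) tensor3" where
  "perm_YB_sum s m xs =
     (\<Sum>(ai, bi)\<leftarrow>xs. \<Sum>(aj, bj)\<leftarrow>xs.
        pure3 s ai (m bi aj) bj - pure3 s ai aj (m bi bj)
        + pure3 s (m ai aj) bi bj - pure3 s (m aj ai) bi bj)"

definition perm_YBE ::
  "('k::field \<Rightarrow> 'a::ab_group_add \<Rightarrow> 'a) \<Rightarrow> ('a \<Rightarrow> 'a \<Rightarrow> 'a) \<Rightarrow>
   ('a, 'k) tensor2 \<Rightarrow> bool" where
  "perm_YBE s m r \<longleftrightarrow>
     r \<in> tensors2 s \<and> (\<forall>xs. r = tensor_of s xs \<longrightarrow> perm_YB_sum s m xs = 0)"

definition R_ad_map ::
  "('k::field \<Rightarrow> 'a::ab_group_add \<Rightarrow> 'a) \<Rightarrow> ('a \<Rightarrow> 'a \<Rightarrow> 'a) \<Rightarrow>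
   'a \<Rightarrow> ('a, 'k) tensor2 \<Rightarrow> ('a, 'k) tensor2" where
  "R_ad_map s m a t = tensor_map s id (right_op m a) t - tensor_map s (ad_op m a) id t"

definition R_ad_invariant ::
  "('k::field \<Rightarrow> 'a::ab_group_add \<Rightarrow> 'a) \<Rightarrow> ('a \<Rightarrow> 'a \<Rightarrow> 'a) \<Rightarrow>
   ('a, 'k) tensor2 \<Rightarrow> bool" where
  "R_ad_invariant s m t \<longleftrightarrow> (\<forall>a. R_ad_map s m a t = 0)"

definition Delta_r ::
  "('k::field \<Rightarrow> 'a::ab_group_add \<Rightarrow> 'a) \<Rightarrow> ('a \<Rightarrow> 'a \<Rightarrow> 'a) \<Rightarrow>
   ('a, 'k) tensor2 \<Rightarrow> 'a \<Rightarrow> ('a, 'k) tensor2" where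
  "Delta_r s m r a = R_ad_map s m a r"

definition quasi_triangular_perm_bialgebra ::
  "('k::field_char_0 \<Rightarrow> 'a::ab_group_add \<Rightarrow> 'a) \<Rightarrow> ('a \<Rightarrow> 'a \<Rightarrow> 'a) \<Rightarrow>
   ('a, 'k) tensor2 \<Rightarrow> bool" where
  "quasi_triangular_perm_bialgebra s m r \<longleftrightarrow>
     perm_bialgebra s m (Delta_r s m r) \<and> perm_YBE s m r \<and>
     R_ad_invariant s m (tscale (1 / 2) (r - tflip r))"

definition factorizable_perm_bialgebra ::
  "('k::field_char_0 \<Rightarrow> 'a::ab_group_add \<Rightarrow> 'a) \<Rightarrow> ('a \<Rightarrow> 'a \<Rightarrow> 'a) \<Rightarrow>
   ('a, 'k) tensor2 \<Rightarrow> bool" where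
  "factorizable_perm_bialgebra s m r \<longleftrightarrow>
     quasi_triangular_perm_bialgebra s m r \<and> dual_linear_iso s (T_map s (r - tflip r))"

definition quadratic_perm_algebra ::
  "('k::field \<Rightarrow> 'a::ab_group_add \<Rightarrow> 'a) \<Rightarrow> ('a \<Rightarrow> 'a \<Rightarrow> 'a) \<Rightarrow> ('a \<Rightarrow> 'a \<Rightarrow> 'k) \<Rightarrow> bool" where
  "quadratic_perm_algebra s m B \<longleftrightarrow>
     perm_algebra s m \<and>
     bilinear_map s s (*) B \<and>
     (\<forall>a. (\<forall>b. B a b = 0) \<longrightarrow> a = 0) \<and>
     (\<forall>a b. B a b = - B b a) \<and>
     (\<forall>a b c. B (m a b) c = B a (m b c - m c b))"

definition sharp :: "('a \<Rightarrow> 'a \<Rightarrow> 'k) \<Rightarrow> 'a \<Rightarrow> ('a \<Rightarrow> 'k)" where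
  "sharp B a = (\<lambda>b. B a b)"

definition rota_baxter_operator ::
  "('k::field \<Rightarrow> 'a::ab_group_add \<Rightarrow> 'a) \<Rightarrow> ('a \<Rightarrow> 'a \<Rightarrow> 'a) \<Rightarrow> 'k \<Rightarrow> ('a \<Rightarrow> 'a) \<Rightarrow> bool" where
  "rota_baxter_operator s m lam P \<longleftrightarrow>
     Vector_Spaces.linear s s P \<and>
     (\<forall>a b. m (P a) (P b) = P (m (P a) b + m a (P b) + s lam (m a b)))"

definition quadratic_rota_baxter_perm_algebra ::
  "('k::field \<Rightarrow> 'a::ab_group_add \<Rightarrow> 'a) \<Rightarrow> ('a \<Rightarrow> 'a \<Rightarrow> 'a) \<Rightarrow> ('a \<Rightarrow> 'a \<Rightarrow> 'k) \<Rightarrow>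
   ('a \<Rightarrow> 'a) \<Rightarrow> 'k \<Rightarrow> bool" where
  "quadratic_rota_baxter_perm_algebra s m B P lam \<longleftrightarrow>
     quadratic_perm_algebra s m B \<and> rota_baxter_operator s m lam P \<and>
     (\<forall>a b. B (P a) b + B a (P b) + lam * B a b = 0)"


lemma fun_sum_list: "sum_list (map F xs) x = sum_list (map (\<lambda>i. F i x) xs)"
  by (induction xs) auto

lemma sum_list_swap:
  fixes q :: "_ \<Rightarrow> _ \<Rightarrow> 'c::comm_monoid_add"
  shows "(\<Sum>x\<leftarrow>xs. \<Sum>y\<leftarrow>ys. q x y) = (\<Sum>y\<leftarrow>ys. \<Sum>x\<leftarrow>xs. q x y)"
  by (induction xs) (simp_all add: sum_list_addf)

lemma tensor_of_simps [simp]: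
  "tensor_of s [] = 0"
  "tensor_of s ((a, b) # xs) = pure2 s a b + tensor_of s xs"
  by (simp_all add: tensor_of_def)

lemma dual_linearD:
  assumes "f \<in> dual s"
  shows "f (x + y) = f x + f y" "f (s c x) = c * f x" "f 0 = 0" "f (x - y) = f x - f y"
proof -
  interpret Vector_Spaces.linear s "(*)" f using assms by (simp add: dual_def)
  show "f (x + y) = f x + f y" "f (s c x) = c * f x" "f 0 = 0" "f (x - y) = f x - f y"
    by (simp_all add: add scale diff)
qed

lemma vector_space_mult: "vector_space ((*) :: 'k::field \<Rightarrow> 'k \<Rightarrow> 'k)"
  by unfold_locales (simp_all add: algebra_simps)

lemma vector_space_tscale: "vector_space (tscale :: 'k::field \<Rightarrow> ('a, 'k) tensor2 \<Rightarrow> _)"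
  by unfold_locales (simp_all add: tscale_def algebra_simps fun_eq_iff)

lemma vector_space_tscale3: "vector_space (tscale3 :: 'k::field \<Rightarrow> ('a, 'k) tensor3 \<Rightarrow> _)"
  by unfold_locales (simp_all add: tscale3_def algebra_simps fun_eq_iff)

lemma linearI:
  assumes "vector_space s1" "vector_space s2"
    and "\<And>x y. f (x + y) = f x + f y" "\<And>c x. f (s1 c x) = s2 c (f x)"
  shows "Vector_Spaces.linear s1 s2 f"
  using assms
  by (simp add: Vector_Spaces.linear_def module_hom_def module_hom_axioms_def
      module_iff_vector_space)

lemma linearD:
  assumes "Vector_Spaces.linear s1 s2 f"
  shows "f (x + y) = f x + f y" "f (s1 c x) = s2 c (f x)" "f 0 = 0" "f (x - y) = f x - f y"
    "vector_space s1" "vector_space s2"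
    "f (sum_list (map F xs)) = (\<Sum>i\<leftarrow>xs. f (F i))"
proof -
  interpret Vector_Spaces.linear s1 s2 f by fact
  show "f (x + y) = f x + f y" "f (s1 c x) = s2 c (f x)" "f 0 = 0" "f (x - y) = f x - f y"
    by (simp_all add: add scale diff)
  show "vector_space s1" "vector_space s2" by unfold_locales
  show "f (sum_list (map F xs)) = (\<Sum>i\<leftarrow>xs. f (F i))"
    by (induction xs) (simp_all add: add)
qed

lemma dual_comp:
  assumes "f \<in> dual s" "Vector_Spaces.linear s s \<phi>"
  shows "f \<circ> \<phi> \<in> dual s"
  using assms linearD[OF assms(2)] vector_space_mult
  by (auto simp: dual_def intro!: linearI dest: linearD)

lemma pure2_bilinear:
  assumes "vector_space s"
  shows "bilinear_map s s tscale (pure2 s)"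
  unfolding bilinear_map_def
  by (auto intro!: linearI assms vector_space_tscale
      simp: pure2_def tscale_def fun_eq_iff dual_linearD algebra_simps)

lemma pure3_trilinear:
  assumes "vector_space s"
  shows "Vector_Spaces.linear s tscale3 (\<lambda>x. pure3 s x b c)"
    "Vector_Spaces.linear s tscale3 (\<lambda>x. pure3 s a x c)"
    "Vector_Spaces.linear s tscale3 (\<lambda>x. pure3 s a b x)"
  by (auto intro!: linearI assms vector_space_tscale3
      simp: pure3_def tscale3_def fun_eq_iff dual_linearD algebra_simps)

lemma tensor_of_eval:
  assumes "f \<in> dual s" "g \<in> dual s"
  shows "tensor_of s xs f g = (\<Sum>(a, b)\<leftarrow>xs. f a * g b)"
  using assms by (induction xs) (auto simp: pure2_def)

lemma tensor_of_eval_not_dual: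
  assumes "f \<notin> dual s \<or> g \<notin> dual s"
  shows "tensor_of s xs f g = 0"
  using assms by (induction xs) (auto simp: pure2_def)

lemma tensor3_of_eval:
  assumes "f \<in> dual s" "g \<in> dual s" "h \<in> dual s"
  shows "tensor3_of s xs f g h = (\<Sum>(a, b, c)\<leftarrow>xs. f a * g b * h c)"
  using assms by (induction xs) (auto simp: pure3_def tensor3_of_def)

context finite_dimensional_vector_space
begin

lemma representation_dual: "(\<lambda>v. representation Basis v e) \<in> dual scale"
  unfolding dual_def
  using independent_Basis span_Basis vector_space_mult
  by (auto intro!: linearI vector_space_axioms simp: representation_add representation_scale)

lemma expand: "v = (\<Sum>e\<in>Basis. scale (representation Basis v e) e)"
  using sum_representation_eq[OF independent_Basis _ finite_Basis order_refl, of v] span_Basis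
  by simp

lemma dual_separates:
  assumes "\<And>g. g \<in> dual scale \<Longrightarrow> g v = g w"
  shows "v = w"
  using assms[OF representation_dual] expand[of v] expand[of w] by simp

lemma linear_expand:
  assumes "Vector_Spaces.linear scale s' \<beta>"
  shows "\<beta> v = (\<Sum>e\<in>Basis. s' (representation Basis v e) (\<beta> e))"
proof -
  interpret l: Vector_Spaces.linear scale s' \<beta> by fact
  show ?thesis by (subst expand[of v]) (simp add: l.sum l.scale)
qed

lemma bilinear_expand:
  assumes "bilinear_map scale scale s' \<beta>"
  shows "\<beta> a b = (\<Sum>d\<in>Basis. \<Sum>e\<in>Basis.
    s' (representation Basis a d * representation Basis b e) (\<beta> d e))"
proof -
  have l: "Vector_Spaces.linear scale s' (\<lambda>a. \<beta> a b)" "Vector_Spaces.linear scale s' (\<beta> a)" for a b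
    using assms by (auto simp: bilinear_map_def)
  interpret w: vector_space s' using linearD(6)[OF l(2)] .
  have "\<beta> a b = (\<Sum>d\<in>Basis. s' (representation Basis a d) (\<beta> d b))"
    using linear_expand[OF l(1)] .
  also have "\<dots> = (\<Sum>d\<in>Basis. s' (representation Basis a d)
      (\<Sum>e\<in>Basis. s' (representation Basis b e) (\<beta> d e)))"
    using linear_expand[OF l(2)] by (intro sum.cong refl arg_cong2[of _ _ _ _ s'])
  finally show ?thesis by (simp add: w.scale_sum_right)
qed

lemma tensor2_universal:
  assumes "bilinear_map scale scale s' \<beta>"
    and "tensor_of scale xs = tensor_of scale ys"
  shows "(\<Sum>(a, b)\<leftarrow>xs. \<beta> a b) = (\<Sum>(a, b)\<leftarrow>ys. \<beta> a b)"
proof -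
  have l: "Vector_Spaces.linear scale s' (\<lambda>a. \<beta> a b)" for b
    using assms by (auto simp: bilinear_map_def)
  interpret w: vector_space s' using linearD(6)[OF l] .
  let ?r = "\<lambda>d v. representation Basis v d"
  have "(\<Sum>(a, b)\<leftarrow>xs. \<beta> a b) =
      (\<Sum>d\<in>Basis. \<Sum>e\<in>Basis. s' (tensor_of scale xs (?r d) (?r e)) (\<beta> d e))" for xs
  proof (induction xs)
    case Nil
    then show ?case by simp
  next
    case (Cons x xs)
    obtain a b where x: "x = (a, b)" by (cases x)
    show ?case using Cons bilinear_expand[OF assms(1), of a b]
      by (simp add: x pure2_def representation_dual w.scale_left_distrib sum.distrib)
  qed
  then show ?thesis using assms(2) by simp
qed

lemma tensor3_universal:
  assumes "\<And>b c. Vector_Spaces.linear scale s' (\<lambda>a. \<gamma> a b c)"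
    and "\<And>a c. Vector_Spaces.linear scale s' (\<lambda>b. \<gamma> a b c)"
    and "\<And>a b. Vector_Spaces.linear scale s' (\<lambda>c. \<gamma> a b c)"
    and "tensor3_of scale xs = tensor3_of scale ys"
  shows "(\<Sum>(a, b, c)\<leftarrow>xs. \<gamma> a b c) = (\<Sum>(a, b, c)\<leftarrow>ys. \<gamma> a b c)"
proof -
  interpret w: vector_space s' using linearD(6)[OF assms(1)] .
  let ?r = "\<lambda>d v. representation Basis v d"
  have ex: "\<gamma> a b c = (\<Sum>d\<in>Basis. \<Sum>e\<in>Basis. \<Sum>i\<in>Basis.
      s' (?r d a * ?r e b * ?r i c) (\<gamma> d e i))" for a b c
  proof -
    have "\<gamma> a b c = (\<Sum>d\<in>Basis. s' (?r d a) (\<gamma> d b c))"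
      using linear_expand[OF assms(1)] .
    also have "\<dots> = (\<Sum>d\<in>Basis. s' (?r d a) (\<Sum>e\<in>Basis. s' (?r e b) (\<gamma> d e c)))"
      using linear_expand[OF assms(2)] by (intro sum.cong refl arg_cong2[of _ _ _ _ s'])
    also have "\<dots> = (\<Sum>d\<in>Basis. s' (?r d a) (\<Sum>e\<in>Basis. s' (?r e b)
        (\<Sum>i\<in>Basis. s' (?r i c) (\<gamma> d e i))))"
      using linear_expand[OF assms(3)] by (intro sum.cong refl arg_cong2[of _ _ _ _ s'])
    finally show ?thesis by (simp add: w.scale_sum_right mult.assoc)
  qed
  have "(\<Sum>(a, b, c)\<leftarrow>xs. \<gamma> a b c) = (\<Sum>d\<in>Basis. \<Sum>e\<in>Basis. \<Sum>i\<in>Basis.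
      s' (tensor3_of scale xs (?r d) (?r e) (?r i)) (\<gamma> d e i))" for xs
  proof (induction xs)
    case Nil
    then show ?case by (simp add: tensor3_of_def)
  next
    case (Cons x xs)
    obtain a b c where x: "x = (a, b, c)" by (cases x)
    show ?case using Cons ex[of a b c]
      by (simp add: x tensor3_of_def pure3_def representation_dual
        w.scale_left_distrib sum.distrib)
  qed
  then show ?thesis using assms(4) by simp
qed

lemma T_map_tensor_of:
  assumes "f \<in> dual scale"
  shows "T_map scale (tensor_of scale xs) f = (\<Sum>(a, b)\<leftarrow>xs. scale (f a) b)"
proof -
  have *: "g (\<Sum>(a, b)\<leftarrow>xs. scale (f a) b) = tensor_of scale xs f g" if "g \<in> dual scale" for g
    using that assms by (induction xs) (auto simp: dual_linearD pure2_def)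
  show ?thesis unfolding T_map_def
  proof (rule the_equality)
    fix v assume "\<forall>g\<in>dual scale. g v = tensor_of scale xs f g"
    then show "v = (\<Sum>(a, b)\<leftarrow>xs. scale (f a) b)"
      using * by (intro dual_separates) metis
  qed (use * in simp)
qed

text \<open>\<open>A \<otimes> A\<close> is identified with \<open>Hom(A\<^sup>*, A)\<close> by \<open>r \<mapsto> T\<^sub>r\<close>.\<close>

lemma T_map_identification:
  assumes "dual_linear scale F"
  shows "\<exists>!r. r \<in> tensors2 scale \<and> (\<forall>f\<in>dual scale. T_map scale r f = F f)"
proof -
  let ?r = "\<lambda>d v. representation Basis v d"
  obtain es where es: "set es = Basis" "distinct es"
    using finite_distinct_list[OF finite_Basis] by blast
  have F0: "F (\<lambda>x. 0) = 0"
    using assms[unfolded dual_linear_def, THEN conjunct2, rule_format, OF representation_dual, of 0]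
    by simp
  have Fsum: "(\<lambda>v. \<Sum>e\<leftarrow>ds. c e * ?r e v) \<in> dual scale \<and>
      F (\<lambda>v. \<Sum>e\<leftarrow>ds. c e * ?r e v) = (\<Sum>e\<leftarrow>ds. scale (c e) (F (?r e)))" for c ds
  proof (induction ds)
    case Nil
    show ?case
      by (simp add: F0) (auto simp: dual_def intro!: linearI vector_space_axioms vector_space_mult)
  next
    case (Cons d ds)
    have 1: "(\<lambda>v. c d * ?r d v) \<in> dual scale"
      by (auto simp: dual_def dual_linearD[OF representation_dual] algebra_simps
          intro!: linearI vector_space_axioms vector_space_mult)
    have 2: "F (\<lambda>v. c d * ?r d v) = scale (c d) (F (?r d))"
      using assms representation_dual unfolding dual_linear_def by simp
    have "(\<lambda>v. c d * ?r d v + (\<Sum>e\<leftarrow>ds. c e * ?r e v)) \<in> dual scale"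
      using dual_linearD[OF 1] dual_linearD[OF conjunct1[OF Cons]]
      by (auto simp: dual_def algebra_simps intro!: linearI vector_space_axioms vector_space_mult)
    moreover have "F (\<lambda>v. c d * ?r d v + (\<Sum>e\<leftarrow>ds. c e * ?r e v)) =
        F (\<lambda>v. c d * ?r d v) + F (\<lambda>v. \<Sum>e\<leftarrow>ds. c e * ?r e v)"
      using assms 1 conjunct1[OF Cons] unfolding dual_linear_def by simp
    ultimately show ?case using 2 Cons by simp
  qed
  have fexp: "f = (\<lambda>v. \<Sum>e\<leftarrow>es. f e * ?r e v)" if "f \<in> dual scale" for f
  proof
    fix v
    have "f v = (\<Sum>e\<in>Basis. ?r e v * f e)"
      using linear_expand[of "(*)" f v] that by (simp add: dual_def)
    then show "f v = (\<Sum>e\<leftarrow>es. f e * ?r e v)"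
      using es by (simp add: sum_list_distinct_conv_sum_set mult.commute)
  qed
  let ?xs = "map (\<lambda>e. (e, F (?r e))) es"
  have "T_map scale (tensor_of scale ?xs) f = F f" if f: "f \<in> dual scale" for f
  proof -
    have "F f = F (\<lambda>v. \<Sum>e\<leftarrow>es. f e * ?r e v)" using fexp[OF f] by simp
    also have "\<dots> = (\<Sum>e\<leftarrow>es. scale (f e) (F (?r e)))" using Fsum by blast
    finally show ?thesis by (simp add: T_map_tensor_of[OF f] o_def)
  qed
  moreover have "r = r'"
    if mem: "r \<in> tensors2 scale" "r' \<in> tensors2 scale"
      and eq: "\<forall>f\<in>dual scale. T_map scale r f = T_map scale r' f" for r r'
  proof (intro ext)
    fix f g
    obtain xs ys where r: "r = tensor_of scale xs" "r' = tensor_of scale ys"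
      using mem by (auto simp: tensors2_def)
    have *: "g (\<Sum>(a, b)\<leftarrow>xs. scale (f a) b) = tensor_of scale xs f g"
      if "f \<in> dual scale" "g \<in> dual scale" for xs
      using that by (induction xs) (auto simp: dual_linearD pure2_def)
    show "r f g = r' f g"
    proof (cases "f \<in> dual scale \<and> g \<in> dual scale")
      case True
      then have "T_map scale r f = T_map scale r' f" using eq by simp
      then have "(\<Sum>(a, b)\<leftarrow>xs. scale (f a) b) = (\<Sum>(a, b)\<leftarrow>ys. scale (f a) b)"
        using True by (simp add: r T_map_tensor_of)
      then have "g (\<Sum>(a, b)\<leftarrow>xs. scale (f a) b) = g (\<Sum>(a, b)\<leftarrow>ys. scale (f a) b)" by simp
      then show ?thesis using True by (simp add: r *)
    next
      case False
      then show ?thesis by (simp add: r tensor_of_eval_not_dual)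
    qed
  qed
  moreover have "tensor_of scale ?xs \<in> tensors2 scale" by (simp add: tensors2_def)
  ultimately show ?thesis by (intro ex1I[of _ "tensor_of scale ?xs"]) auto
qed

end

lemma tensor_map_tensor_of:
  assumes "Vector_Spaces.linear s s \<phi>" "Vector_Spaces.linear s s \<psi>"
  shows "tensor_map s \<phi> \<psi> (tensor_of s xs) = (\<Sum>(a, b)\<leftarrow>xs. pure2 s (\<phi> a) (\<psi> b))"
proof (induction xs)
  case Nil
  then show ?case by (simp add: tensor_map_def fun_eq_iff)
next
  case (Cons x xs)
  obtain a b where x: "x = (a, b)" by (cases x)
  have "tensor_map s \<phi> \<psi> (tensor_of s (x # xs)) =
      pure2 s (\<phi> a) (\<psi> b) + tensor_map s \<phi> \<psi> (tensor_of s xs)"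
    by (auto simp: x tensor_map_def fun_eq_iff pure2_def dual_comp[OF _ assms(1)]
      dual_comp[OF _ assms(2)])
  then show ?case by (simp only: x Cons list.map sum_list.Cons case_prod_conv)
qed

lemma tflip_tensor_of: "tflip (tensor_of s xs) = (\<Sum>(a, b)\<leftarrow>xs. pure2 s b a)"
proof (induction xs)
  case Nil
  then show ?case by (simp add: tflip_def fun_eq_iff)
next
  case (Cons x xs)
  obtain a b where x: "x = (a, b)" by (cases x)
  have "tflip (tensor_of s (x # xs)) = pure2 s b a + tflip (tensor_of s xs)"
    by (auto simp: x tflip_def fun_eq_iff pure2_def)
  then show ?case by (simp only: x Cons list.map sum_list.Cons case_prod_conv)
qed

lemma dual_coproduct:
  assumes "Vector_Spaces.linear s tscale \<Delta>"
  shows "(\<lambda>a. \<Delta> a f g) \<in> dual s"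
  using linearD[OF assms] vector_space_mult
  by (auto simp: dual_def tscale_def intro!: linearI)

lemma apply_left_tensor_of:
  assumes "Vector_Spaces.linear s tscale \<Delta>" and "\<And>a. \<Delta> a = tensor_of s (D a)"
  shows "apply_left s \<Delta> (tensor_of s xs) = (\<Sum>(a, b)\<leftarrow>xs. \<Sum>(u, v)\<leftarrow>D a. pure3 s u v b)"
proof -
  have *: "(\<Sum>(u, v)\<leftarrow>ys. pure3 s u v b) f g h =
      (if f \<in> dual s \<and> g \<in> dual s \<and> h \<in> dual s then tensor_of s ys f g * h b else 0)" for ys b f g h
    by (induction ys) (auto simp: pure3_def pure2_def algebra_simps)
  show ?thesis
  proof (induction xs)
    case Nil
    then show ?case by (simp add: apply_left_def fun_eq_iff)
  next
    case (Cons x xs)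
    obtain a b where x: "x = (a, b)" by (cases x)
    have "apply_left s \<Delta> (tensor_of s (x # xs)) =
        apply_left s \<Delta> (pure2 s a b) + apply_left s \<Delta> (tensor_of s xs)"
      by (simp add: x apply_left_def fun_eq_iff)
    moreover have "apply_left s \<Delta> (pure2 s a b) = (\<Sum>(u, v)\<leftarrow>D a. pure3 s u v b)"
      unfolding fun_eq_iff *
      by (simp add: apply_left_def pure2_def dual_coproduct[OF assms(1)] assms(2)[symmetric])
    ultimately show ?case by (simp only: x Cons list.map sum_list.Cons case_prod_conv)
  qed
qed

lemma apply_right_tensor_of:
  assumes "Vector_Spaces.linear s tscale \<Delta>" and "\<And>a. \<Delta> a = tensor_of s (D a)"
  shows "apply_right s \<Delta> (tensor_of s xs) = (\<Sum>(a, b)\<leftarrow>xs. \<Sum>(u, v)\<leftarrow>D b. pure3 s a u v)"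
proof -
  have *: "(\<Sum>(u, v)\<leftarrow>ys. pure3 s a u v) f g h =
      (if f \<in> dual s \<and> g \<in> dual s \<and> h \<in> dual s then f a * tensor_of s ys g h else 0)" for ys a f g h
    by (induction ys) (auto simp: pure3_def pure2_def algebra_simps)
  show ?thesis
  proof (induction xs)
    case Nil
    then show ?case by (simp add: apply_right_def fun_eq_iff)
  next
    case (Cons x xs)
    obtain a b where x: "x = (a, b)" by (cases x)
    have "apply_right s \<Delta> (tensor_of s (x # xs)) =
        apply_right s \<Delta> (pure2 s a b) + apply_right s \<Delta> (tensor_of s xs)"
      by (simp add: x apply_right_def fun_eq_iff)
    moreover have "apply_right s \<Delta> (pure2 s a b) = (\<Sum>(u, v)\<leftarrow>D b. pure3 s a u v)"
      unfolding fun_eq_iff *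
      by (simp add: apply_right_def pure2_def dual_coproduct[OF assms(1)] assms(2)[symmetric])
    ultimately show ?case by (simp only: x Cons list.map sum_list.Cons case_prod_conv)
  qed
qed

lemma tflip12_tensor3_of: "tflip12 (tensor3_of s xs) = (\<Sum>(a, b, c)\<leftarrow>xs. pure3 s b a c)"
proof (induction xs)
  case Nil
  then show ?case by (simp add: tflip12_def tensor3_of_def fun_eq_iff)
next
  case (Cons x xs)
  obtain a b c where x: "x = (a, b, c)" by (cases x)
  have "tflip12 (tensor3_of s (x # xs)) = pure3 s b a c + tflip12 (tensor3_of s xs)"
    by (auto simp: x tflip12_def tensor3_of_def fun_eq_iff pure3_def)
  then show ?case by (simp only: x Cons list.map sum_list.Cons case_prod_conv)
qed

lemma perm_YB_sum_cong:
  assumes "finite_dimensional_vector_space s Basis" and "bilinear_map s s s m"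
    and eq: "tensor_of s xs = tensor_of s ys"
  shows "perm_YB_sum s m xs = perm_YB_sum s m ys"
proof -
  interpret finite_dimensional_vector_space s Basis by fact
  define q where "q = (\<lambda>a b a' b'. pure3 s a (m b a') b' - pure3 s a a' (m b b')
        + pure3 s (m a a') b b' - pure3 s (m a' a) b b')"
  note p3 = pure3_trilinear[OF vector_space_axioms]
  note p3D = linearD(1,2)[OF p3(1)] linearD(1,2)[OF p3(2)] linearD(1,2)[OF p3(3)]
  have m1: "Vector_Spaces.linear s s (m x)" and m2: "Vector_Spaces.linear s s (\<lambda>y. m y x)" for x
    using assms(2) by (auto simp: bilinear_map_def)
  note mD = linearD(1,2)[OF m1] linearD(1,2)[OF m2]
  interpret t: vector_space "tscale3 :: 'a \<Rightarrow> ('b, 'a) tensor3 \<Rightarrow> _"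
    by (rule vector_space_tscale3)
  note sc = t.scale_right_distrib t.scale_right_diff_distrib
  have q1: "bilinear_map s s tscale3 (\<lambda>a b. q a b a' b')" for a' b'
    unfolding bilinear_map_def q_def
    by (intro conjI allI linearI vector_space_axioms vector_space_tscale3)
      (simp_all add: p3D mD sc algebra_simps)
  have q2: "bilinear_map s s tscale3 (\<lambda>a' b'. q a b a' b')" for a b
    unfolding bilinear_map_def q_def
    by (intro conjI allI linearI vector_space_axioms vector_space_tscale3)
      (simp_all add: p3D mD sc algebra_simps)
  have "perm_YB_sum s m xs = (\<Sum>(a, b)\<leftarrow>xs. \<Sum>(a', b')\<leftarrow>xs. q a b a' b')"
    by (simp add: perm_YB_sum_def q_def)
  also have "\<dots> = (\<Sum>(a, b)\<leftarrow>xs. \<Sum>(a', b')\<leftarrow>ys. q a b a' b')"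
    using tensor2_universal[OF q2 eq] by simp
  also have "\<dots> = (\<Sum>(a', b')\<leftarrow>ys. \<Sum>(a, b)\<leftarrow>xs. q a b a' b')"
    unfolding case_prod_beta by (rule sum_list_swap)
  also have "\<dots> = (\<Sum>(a', b')\<leftarrow>ys. \<Sum>(a, b)\<leftarrow>ys. q a b a' b')"
    using tensor2_universal[OF q1 eq] by simp
  also have "\<dots> = (\<Sum>(a, b)\<leftarrow>ys. \<Sum>(a', b')\<leftarrow>ys. q a b a' b')"
    unfolding case_prod_beta by (rule sum_list_swap)
  also have "\<dots> = perm_YB_sum s m ys" by (simp add: perm_YB_sum_def q_def)
  finally show ?thesis .
qed

end

theory Submission
  imports Defs
begin

text \<open>
  Since \<open>B\<close> is nondegenerate, every functional is \<open>B(x, -)\<close> for a unique \<open>x\<close>, so tensors become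
  forms on \<open>A\<close>. Invariance of \<open>B\<close> makes \<open>R(a)\<close> and \<open>ad(a)\<close> mutually adjoint and \<open>L(a)\<close> self-adjoint,
  and the compatibility of \<open>B\<close> with \<open>P\<close> says that \<open>P\<close> has adjoint \<open>-P - \<lambda>\<close>. In these terms \<open>r\<close> is
  the form \<open>(x, y) \<mapsto> B(y, P x)\<close>, the Yang--Baxter equation is the Rota--Baxter identity, and
  \<open>r - \<sigma>(r)\<close> is \<open>\<lambda> B\<close>, whence invariance and, as \<open>\<lambda> \<noteq> 0\<close>, factorizability. The coproduct
  \<open>\<Delta>\<^sub>r\<close> is dual to the product \<open>x \<circ> y = P(x) y + x P(y) + \<lambda> x y\<close>, which is again a perm product.
\<close>

section \<open>Quadratic Rota-Baxter perm algebras and adjoints under \<open>B\<close>\<close>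

locale quadratic_rota_baxter_perm = finite_dimensional_vector_space s Basis
  for s :: "'k::field_char_0 \<Rightarrow> 'a::ab_group_add \<Rightarrow> 'a" and Basis :: "'a set" +
  fixes m :: "'a \<Rightarrow> 'a \<Rightarrow> 'a" (infixl \<open>\<cdot>\<close> 70)
    and B :: "'a \<Rightarrow> 'a \<Rightarrow> 'k"
    and P :: "'a \<Rightarrow> 'a"
    and lam :: 'k
  assumes qrb: "quadratic_rota_baxter_perm_algebra s m B P lam"
begin

lemma perm_algebra: "perm_algebra s m"
  and bilinear_mult: "bilinear_map s s s m"
  and bilinear_form: "bilinear_map s s (*) B"
  and linear_P: "Vector_Spaces.linear s s P"
  using qrb by (auto simp: quadratic_rota_baxter_perm_algebra_def quadratic_perm_algebra_def
      perm_algebra_def rota_baxter_operator_def)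

lemma linear_mult: "Vector_Spaces.linear s s (m a)" "Vector_Spaces.linear s s (\<lambda>x. x \<cdot> a)"
  using bilinear_mult by (auto simp: bilinear_map_def)

lemma linear_form: "Vector_Spaces.linear s (*) (B a)" "Vector_Spaces.linear s (*) (\<lambda>x. B x a)"
  using bilinear_form by (auto simp: bilinear_map_def)

lemma uminus_linear:
  assumes "Vector_Spaces.linear s1 s2 f"
  shows "f (- x) = - f x"
  using linearD(4)[OF assms, of 0 x] linearD(3)[OF assms] by simp

lemmas linear_simps =
  linearD(1-4)[OF linear_P] uminus_linear[OF linear_P]
  linearD(1-4)[OF linear_mult(1)] uminus_linear[OF linear_mult(1)]
  linearD(1-4)[OF linear_mult(2)] uminus_linear[OF linear_mult(2)]
  linearD(1-4)[OF linear_form(1)] uminus_linear[OF linear_form(1)]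
  linearD(1-4)[OF linear_form(2)] uminus_linear[OF linear_form(2)]

lemma perm_assoc: "a \<cdot> b \<cdot> c = a \<cdot> (b \<cdot> c)"
  and perm_left_commute: "b \<cdot> (a \<cdot> c) = a \<cdot> (b \<cdot> c)"
  using perm_algebra unfolding perm_algebra_def by metis+

lemma form_skew: "B a b = - B b a"
  and form_nondegenerate: "(\<And>b. B a b = 0) \<Longrightarrow> a = 0"
  and form_invariant: "B (a \<cdot> b) c = B a (b \<cdot> c - c \<cdot> b)"
  using qrb unfolding quadratic_rota_baxter_perm_algebra_def quadratic_perm_algebra_def by metis+

lemma rota_baxter: "P a \<cdot> P b = P (P a \<cdot> b + a \<cdot> P b + s lam (a \<cdot> b))"
  using qrb by (simp add: quadratic_rota_baxter_perm_algebra_def rota_baxter_operator_def)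

lemma form_right: "B x (b \<cdot> a) = B (a \<cdot> x - x \<cdot> a) b"
  using form_invariant[of b a x] form_skew by metis

lemma form_ad: "B x (a \<cdot> b - b \<cdot> a) = B (x \<cdot> a) b"
  by (simp add: form_invariant)

text \<open>\<open>L(a)\<close> is the sum of the mutually adjoint maps \<open>R(a)\<close> and
  \<open>ad(a)\<close>.\<close>

lemma form_left: "B x (a \<cdot> b) = B (a \<cdot> x) b"
  using form_ad[of x a b] form_right[of x b a] by (simp add: linear_simps)

lemma form_P: "B x (P y) = - B (P x) y - lam * B x y"
  using qrb by (simp add: quadratic_rota_baxter_perm_algebra_def algebra_simps
    eq_neg_iff_add_eq_0)

text \<open>Skew-symmetry absorbs the sign of the adjoint \<open>-P - lam\<close>, so
  \<open>P\<close> can be moved across \<open>B\<close> without a sign when the two arguments are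
  exchanged.\<close>

lemma form_P_swap: "B x (P y) = B y (P x + s lam x)"
  using form_P[of y x] form_skew[of x "P y"] by (simp add: linear_simps)

section \<open>The identification of A with its dual\<close>

lemma sharp_apply: "sharp B x y = B x y"
  by (simp add: sharp_def)

lemma sharp_dual: "sharp B x \<in> dual s"
  using linear_form(1) by (simp add: sharp_def dual_def)

lemma inj_sharp: "inj (sharp B)"
proof (rule injI)
  fix x y assume "sharp B x = sharp B y"
  then have "B (x - y) b = 0" for b by (simp add: sharp_def linear_simps fun_eq_iff)
  then show "x = y" using form_nondegenerate[of "x - y"] by simp
qed

text \<open>In coordinates \<open>sharp B\<close> is an injective endomorphism of \<open>A\<close>, hence surjective.\<close>

lemma dual_eq_sharp:
  assumes f: "f \<in> dual s"
  obtains x where "f = sharp B x"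
proof -
  define \<Phi> where "\<Phi> = (\<lambda>x. \<Sum>e\<in>Basis. s (B x e) e)"
  have lin: "Vector_Spaces.linear s s \<Phi>"
    by (intro linearI vector_space_axioms)
      (simp_all add: \<Phi>_def linear_simps scale_left_distrib sum.distrib scale_sum_right)
  have eq: "h e = g e" if "(\<Sum>e\<in>Basis. s (h e) e) = (\<Sum>e\<in>Basis. s (g e) e)" "e \<in> Basis" for h g e
  proof -
    have "(\<Sum>e\<in>Basis. s (h e - g e) e) = 0"
      using that by (simp add: scale_left_diff_distrib sum_subtractf)
    then show ?thesis
      using independentD[OF independent_Basis finite_Basis order_refl _ that(2),
        where u = "\<lambda>e. h e - g e"] by simp
  qed
  have agree: "k = l" if "k \<in> dual s" "l \<in> dual s" "\<And>e. e \<in> Basis \<Longrightarrow> k e = l e" for k l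
  proof
    fix v
    have "k v = (\<Sum>e\<in>Basis. representation Basis v e * k e)"
      "l v = (\<Sum>e\<in>Basis. representation Basis v e * l e)"
      using that(1,2) by (auto simp: dual_def intro: linear_expand)
    then show "k v = l v" using that(3) by simp
  qed
  have "inj \<Phi>"
  proof (rule injI)
    fix x y assume "\<Phi> x = \<Phi> y"
    then have "sharp B x e = sharp B y e" if "e \<in> Basis" for e
      using that eq[of "B x" "B y"] by (simp add: \<Phi>_def sharp_def)
    then show "x = y" using agree[OF sharp_dual sharp_dual] inj_sharp by (metis injD)
  qed
  then have "surj \<Phi>" using linear_inj_imp_surj[OF lin] by simp
  then obtain x where "\<Phi> x = (\<Sum>e\<in>Basis. s (f e) e)" by (metis surjD)
  then have "f = sharp B x"
    using eq[of "B x" f] by (intro agree f sharp_dual) (simp add: \<Phi>_def sharp_def)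
  then show thesis using that by blast
qed

lemma inv_sharp [simp]: "inv (sharp B) (sharp B x) = x"
  by (simp add: inj_sharp)

lemma sharp_comp:
  "sharp B x \<circ> right_op m a = sharp B (a \<cdot> x - x \<cdot> a)"
  "sharp B x \<circ> ad_op m a = sharp B (x \<cdot> a)"
  "sharp B x \<circ> left_op m a = sharp B (a \<cdot> x)"
proof -
  show "sharp B x \<circ> right_op m a = sharp B (a \<cdot> x - x \<cdot> a)"
    by (simp add: fun_eq_iff sharp_apply right_op_def form_right)
  show "sharp B x \<circ> ad_op m a = sharp B (x \<cdot> a)"
    by (simp add: fun_eq_iff sharp_apply right_op_def ad_op_def left_op_def form_ad)
  show "sharp B x \<circ> left_op m a = sharp B (a \<cdot> x)"
    by (simp add: fun_eq_iff sharp_apply left_op_def form_left)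
qed

section \<open>Testing tensors on the functionals \<open>sharp B x\<close>\<close>

lemma tensor_map_sharp:
  "tensor_map s \<phi> \<psi> t (sharp B x) (sharp B y) = t (sharp B x \<circ> \<phi>) (sharp B y \<circ> \<psi>)"
  by (simp add: tensor_map_def sharp_dual)

text \<open>Tensors are functions on all pairs of maps, with default value 0 off the dual. This
  condition records the default, so that equality need only be tested on \<open>sharp B x\<close>
  and \<open>sharp B y\<close>.\<close>

definition supported2 :: "('a, 'k) tensor2 \<Rightarrow> bool" where
  "supported2 t \<longleftrightarrow> (\<forall>f g. f \<notin> dual s \<or> g \<notin> dual s \<longrightarrow> t f g = 0)"

lemma supported2_simps [simp]:
  "supported2 (tensor_of s xs)"
  "supported2 (tensor_map s \<phi> \<psi> t)"
  "supported2 t \<Longrightarrow> supported2 (tflip t)"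
  "supported2 t \<Longrightarrow> supported2 u \<Longrightarrow> supported2 (t + u)"
  "supported2 t \<Longrightarrow> supported2 u \<Longrightarrow> supported2 (t - u)"
  "supported2 t \<Longrightarrow> supported2 (tscale c t)"
  "supported2 0"
  by (auto simp: supported2_def tensor_of_eval_not_dual tensor_map_def tflip_def tscale_def)

lemma tensor2_eqI:
  assumes "supported2 t" "supported2 u"
    and "\<And>x y. t (sharp B x) (sharp B y) = u (sharp B x) (sharp B y)"
  shows "t = u"
proof (intro ext)
  fix f g
  show "t f g = u f g"
    using assms by (cases "f \<in> dual s \<and> g \<in> dual s") (auto simp: supported2_def elim!: dual_eq_sharp)
qed

lemma tensor3_eqI:
  assumes "\<And>f g h. f \<notin> dual s \<or> g \<notin> dual s \<or> h \<notin> dual s \<Longrightarrow> t f g h = u f g h"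
    and "\<And>x y z. t (sharp B x) (sharp B y) (sharp B z) = u (sharp B x) (sharp B y) (sharp B z)"
  shows "t = u"
proof (intro ext)
  fix f g h
  show "t f g h = u f g h"
    using assms by (cases "f \<in> dual s \<and> g \<in> dual s \<and> h \<in> dual s") (auto elim!: dual_eq_sharp)
qed

section \<open>The perm product induced by the Rota-Baxter operator\<close>

definition circ :: "'a \<Rightarrow> 'a \<Rightarrow> 'a" (infixl \<open>\<odot>\<close> 70) where
  "x \<odot> y = P x \<cdot> y + x \<cdot> P y + s lam (x \<cdot> y)"

lemma P_circ: "P (x \<odot> y) = P x \<cdot> P y"
  by (simp add: circ_def rota_baxter)

text \<open>Unfolding only the outer product first lets \<open>P_circ\<close> remove
  \<open>P\<close> from the inner one. Both sides then expand into the same words in x, y, z and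
  their images under \<open>P\<close>.\<close>

lemma circ_assoc: "x \<odot> y \<odot> z = x \<odot> (y \<odot> z)"
  unfolding circ_def[of "x \<odot> y"] circ_def[of x "y \<odot> z"] P_circ
  by (simp add: circ_def linear_simps perm_assoc scale_right_distrib algebra_simps)

lemma circ_left_commute: "x \<odot> y \<odot> z = y \<odot> x \<odot> z"
  unfolding circ_def[of "x \<odot> y"] circ_def[of "y \<odot> x"] P_circ
  by (simp add: circ_def linear_simps perm_assoc perm_left_commute scale_right_distrib algebra_simps)

end

section \<open>The tensor \<open>r\<close> as a form on A\<close>

locale rota_baxter_tensor = quadratic_rota_baxter_perm s Basis m B P lam
  for s :: "'k::field_char_0 \<Rightarrow> 'a::ab_group_add \<Rightarrow> 'a" and Basis :: "'a set"
    and m :: "'a \<Rightarrow> 'a \<Rightarrow> 'a" (infixl \<open>\<cdot>\<close> 70)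
    and B :: "'a \<Rightarrow> 'a \<Rightarrow> 'k" and P :: "'a \<Rightarrow> 'a" and lam :: 'k +
  fixes r :: "('a, 'k) tensor2"
  assumes r_tensor: "r \<in> tensors2 s"
    and T_map_r: "\<And>f. f \<in> dual s \<Longrightarrow> T_map s r f = P (inv (sharp B) f)"
begin

abbreviation "\<Delta> \<equiv> Delta_r s m r"

text \<open>This is \<open>T_map s r (sharp B x) = P x\<close> paired with \<open>g\<close>. It
  evaluates any sum over a representative whose first leg is paired with \<open>B x\<close>.\<close>

lemma contract:
  assumes "r = tensor_of s xs" "g \<in> dual s"
  shows "(\<Sum>(a, b)\<leftarrow>xs. B x a * g b) = g (P x)"
proof -
  have "P x = (\<Sum>(a, b)\<leftarrow>xs. s (B x a) b)"
    using T_map_r[OF sharp_dual, of x] T_map_tensor_of[OF sharp_dual, of xs x]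
    by (simp add: assms(1) sharp_apply)
  moreover have "g (\<Sum>(a, b)\<leftarrow>xs. s (B x a) b) = (\<Sum>(a, b)\<leftarrow>xs. B x a * g b)"
    by (induction xs) (auto simp: dual_linearD[OF assms(2)])
  ultimately show ?thesis by simp
qed

lemma r_sharp: "r (sharp B x) (sharp B y) = B y (P x)"
proof -
  obtain xs where xs: "r = tensor_of s xs" using r_tensor by (auto simp: tensors2_def)
  have "r (sharp B x) (sharp B y) = (\<Sum>(a, b)\<leftarrow>xs. B x a * sharp B y b)"
    unfolding xs tensor_of_eval[OF sharp_dual sharp_dual] by (simp add: sharp_apply)
  then show ?thesis using contract[OF xs sharp_dual] by (simp add: sharp_apply)
qed

lemma supported2_r [simp]: "supported2 r" "supported2 (\<Delta> a)"
  using r_tensor by (auto simp: tensors2_def Delta_r_def R_ad_map_def)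

section \<open>The coproduct and the coalgebra axioms\<close>

lemma Delta_sharp: "\<Delta> a (sharp B x) (sharp B y) = B y (P x \<cdot> a - P (x \<cdot> a))"
  by (simp add: Delta_r_def R_ad_map_def tensor_map_sharp sharp_comp r_sharp form_right linear_simps)

text \<open>Self-adjointness of left multiplication gives the term with \<open>P x\<close>, and the
  adjoint \<open>-P - lam\<close> gives the other two. As a function of \<open>a\<close>, the right
  side is again of the form \<open>sharp B\<close>, so the formula can be iterated.\<close>

lemma Delta_sharp_circ: "\<Delta> a (sharp B x) (sharp B y) = sharp B (x \<odot> y) a"
  by (simp add: Delta_sharp sharp_apply)
    (simp add: circ_def linear_simps form_P form_left)

lemma linear_Delta: "Vector_Spaces.linear s tscale \<Delta>"
  by (intro linearI vector_space_axioms vector_space_tscale tensor2_eqI)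
    (simp_all, simp_all add: tscale_def Delta_sharp linear_simps algebra_simps)

lemma Delta_tensor: "\<Delta> a \<in> tensors2 s"
proof -
  obtain xs where xs: "r = tensor_of s xs" using r_tensor by (auto simp: tensors2_def)
  have lin: "Vector_Spaces.linear s s (right_op m a)" "Vector_Spaces.linear s s (ad_op m a)"
    "Vector_Spaces.linear s s id"
    by (auto intro!: linearI vector_space_axioms
      simp: right_op_def ad_op_def left_op_def linear_simps algebra_simps scale_right_diff_distrib)
  have app: "tensor_of s (ys @ zs) = tensor_of s ys + tensor_of s zs" for ys zs
    by (simp add: tensor_of_def)
  have neg: "pure2 s (- u) v = - pure2 s u v" for u v
    using pure2_bilinear[OF vector_space_axioms] unfolding bilinear_map_def
    by (intro uminus_linear[where f = "\<lambda>u. pure2 s u v"]) blast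
  \<comment> \<open>Representatives are sums without coefficients, so the minus sign goes into the
    first factor.\<close>
  have "tensor_of s (map (\<lambda>(u, v). (- ad_op m a u, v)) xs) =
      - tensor_map s (ad_op m a) id (tensor_of s xs)"
    unfolding tensor_map_tensor_of[OF lin(2,3)]
    by (induction xs) (auto simp: neg fun_eq_iff)
  moreover have "tensor_of s (map (\<lambda>(u, v). (u, right_op m a v)) xs) =
      tensor_map s id (right_op m a) (tensor_of s xs)"
    unfolding tensor_map_tensor_of[OF lin(3,1)]
    by (induction xs) (auto simp: fun_eq_iff)
  ultimately have "\<Delta> a = tensor_of s (map (\<lambda>(u, v). (u, right_op m a v)) xs @
      map (\<lambda>(u, v). (- ad_op m a u, v)) xs)"
    by (simp add: app Delta_r_def R_ad_map_def xs)
  then show ?thesis by (simp add: tensors2_def)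
qed

lemma apply_Delta_sharp:
  "apply_left s \<Delta> (\<Delta> a) (sharp B x) (sharp B y) (sharp B z) = B (x \<odot> y \<odot> z) a"
  "apply_right s \<Delta> (\<Delta> a) (sharp B x) (sharp B y) (sharp B z) = B (x \<odot> (y \<odot> z)) a"
  by (simp_all add: apply_left_def apply_right_def sharp_dual Delta_sharp_circ flip: sharp_apply)

lemma perm_coalgebra_Delta: "perm_coalgebra s \<Delta>"
proof -
  have "apply_left s \<Delta> (\<Delta> a) = apply_right s \<Delta> (\<Delta> a)" for a
    by (rule tensor3_eqI) (unfold apply_Delta_sharp circ_assoc,
        auto simp: apply_left_def apply_right_def)
  moreover have "apply_left s \<Delta> (\<Delta> a) = tflip12 (apply_left s \<Delta> (\<Delta> a))" for a
  proof (rule tensor3_eqI)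
    fix x y z
    show "apply_left s \<Delta> (\<Delta> a) (sharp B x) (sharp B y) (sharp B z) =
        tflip12 (apply_left s \<Delta> (\<Delta> a)) (sharp B x) (sharp B y) (sharp B z)"
      unfolding tflip12_def apply_Delta_sharp using circ_left_commute by simp
  qed (auto simp: tflip12_def apply_left_def)
  ultimately show ?thesis
    unfolding perm_coalgebra_def using linear_Delta Delta_tensor by simp
qed

section \<open>The bialgebra compatibilities\<close>

lemma perm_bialgebra_Delta: "perm_bialgebra s m \<Delta>"
proof -
  \<comment> \<open>Evaluated at x and y, the two terms with
    \<open>P (x \<cdot> a) \<cdot> b\<close> cancel; associativity matches the rest.\<close>
  have 1: "\<Delta> (a \<cdot> b) = tensor_map s (ad_op m a) id (\<Delta> b) + tensor_map s id (right_op m b) (\<Delta> a)"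
    for a b
    by (rule tensor2_eqI) (simp_all add: tensor_map_sharp sharp_comp Delta_sharp
        flip: form_right, simp add: linear_simps perm_assoc)
  have 2: "tflip (tensor_map s (right_op m b) id (\<Delta> a)) = tensor_map s (right_op m a) id (\<Delta> b)"
    for a b
  proof (rule tensor2_eqI)
    fix x y
    \<comment> \<open>These represent the functionals of x and y after composition with
      \<open>R(a)\<close> and \<open>R(b)\<close>. Commutators annihilate everything to their right,
      so only \<open>B u (P v)\<close> and \<open>B v (P u)\<close> survive; they differ by a
      multiple of \<open>B u v\<close>, which is 0.\<close>
    define u v where "u = a \<cdot> x - x \<cdot> a" and "v = b \<cdot> y - y \<cdot> b"
    have ann: "u \<cdot> w = 0" "v \<cdot> w = 0" for w
      by (simp_all add: u_def v_def linear_simps perm_assoc perm_left_commute)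
    have "B x (P v \<cdot> a) = B u (P v)" "B y (P u \<cdot> b) = B v (P u)"
      by (simp_all add: form_right u_def v_def)
    moreover have "B u v = 0"
      unfolding v_def form_ad ann by (simp add: linear_simps)
    then have "B u (P v) = B v (P u)"
      using form_P[of u v] form_skew[of "P u" v] by simp
    ultimately show "tflip (tensor_map s (right_op m b) id (\<Delta> a)) (sharp B x) (sharp B y) =
        tensor_map s (right_op m a) id (\<Delta> b) (sharp B x) (sharp B y)"
      by (simp add: tflip_def tensor_map_sharp sharp_comp Delta_sharp ann linear_simps
          flip: u_def v_def)
  qed simp_all
  have 3: "\<Delta> (a \<cdot> b) = tensor_map s id (left_op m a) (\<Delta> b)
      + tensor_map s (ad_op m b) id (\<Delta> a - tflip (\<Delta> a))" for a b
  proof (rule tensor2_eqI)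
    fix x y
    \<comment> \<open>The flipped coproduct has \<open>P\<close> on terms in y. Swapping rewrites
      everything as \<open>B y\<close> of a vector, where the \<open>lam\<close> terms
      cancel.\<close>
    have "B (x \<cdot> b) (P y \<cdot> a) = B y (P (a \<cdot> (x \<cdot> b) - x \<cdot> b \<cdot> a) + s lam (a \<cdot> (x \<cdot> b) - x \<cdot> b \<cdot> a))"
      unfolding form_right[of "x \<cdot> b"] by (rule form_P_swap)
    moreover have "B (x \<cdot> b) (P (y \<cdot> a)) = B y (a \<cdot> (P (x \<cdot> b) + s lam (x \<cdot> b))
        - (P (x \<cdot> b) + s lam (x \<cdot> b)) \<cdot> a)"
      unfolding form_ad by (rule form_P_swap)
    ultimately show "\<Delta> (a \<cdot> b) (sharp B x) (sharp B y) =
        (tensor_map s id (left_op m a) (\<Delta> b)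
          + tensor_map s (ad_op m b) id (\<Delta> a - tflip (\<Delta> a))) (sharp B x) (sharp B y)"
      by (simp add: tflip_def tensor_map_sharp sharp_comp Delta_sharp form_left[of y, symmetric]
          linear_simps perm_assoc perm_left_commute right_diff_distrib)
  qed simp_all
  show ?thesis
    unfolding perm_bialgebra_def using perm_algebra perm_coalgebra_Delta 1 2 3 by blast
qed

section \<open>The perm Yang-Baxter equation\<close>

lemma perm_YB_sum_r:
  assumes xs: "r = tensor_of s xs"
  shows "perm_YB_sum s m xs = 0"
proof (rule tensor3_eqI)
  fix f g h assume "f \<notin> dual s \<or> g \<notin> dual s \<or> h \<notin> dual s"
  then have [simp]: "pure3 s a b c f g h = 0" for a b c
    by (auto simp: pure3_def)
  show "perm_YB_sum s m xs f g h = 0 f g h"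
    by (simp add: perm_YB_sum_def fun_sum_list case_prod_beta)
next
  fix x y z
  \<comment> \<open>These are the functionals of the second leg that arise when the double sums are
    contracted one copy of \<open>r\<close> at a time.\<close>
  have dual: "(\<lambda>b. B z (P (b \<cdot> y))) \<in> dual s" "(\<lambda>b. B z (b \<cdot> P y)) \<in> dual s"
    "(\<lambda>b. B z (a \<cdot> b)) \<in> dual s" "B z \<in> dual s" for y z a
    by (auto simp: dual_def linear_simps intro!: linearI vector_space_axioms vector_space_mult)
  note contr = contract[OF xs dual(1)] contract[OF xs dual(2)] contract[OF xs dual(3)]
    contract[OF xs dual(4)]
  note expand_sum = case_prod_unfold sum_list_const_mult mult.assoc
  define w where "w = x \<cdot> (P z + s lam z)"
  have "(\<Sum>(a, b)\<leftarrow>xs. \<Sum>(a', b')\<leftarrow>xs. B x a * B y (b \<cdot> a') * B z b') =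
      (\<Sum>(a, b)\<leftarrow>xs. B x a * (\<Sum>(a', b')\<leftarrow>xs. B (b \<cdot> y) a' * B z b'))"
    by (simp add: expand_sum form_left)
  also have "\<dots> = B z (P (P x \<cdot> y))" unfolding contr ..
  finally have 1: "(\<Sum>(a, b)\<leftarrow>xs. \<Sum>(a', b')\<leftarrow>xs. B x a * B y (b \<cdot> a') * B z b') =
      B z (P (P x \<cdot> y))" .
  have "(\<Sum>(a, b)\<leftarrow>xs. \<Sum>(a', b')\<leftarrow>xs. B x a * B y a' * B z (b \<cdot> b')) =
      (\<Sum>(a, b)\<leftarrow>xs. B x a * (\<Sum>(a', b')\<leftarrow>xs. B y a' * B z (b \<cdot> b')))"
    by (simp add: expand_sum)
  also have "\<dots> = B z (P x \<cdot> P y)" unfolding contr ..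
  finally have 2: "(\<Sum>(a, b)\<leftarrow>xs. \<Sum>(a', b')\<leftarrow>xs. B x a * B y a' * B z (b \<cdot> b')) =
      B z (P x \<cdot> P y)" .
  \<comment> \<open>In the third sum the inner contraction leaves a functional of the outer first
    leg \<open>a\<close>. It must be written as \<open>B (- w) a\<close> before
    \<open>contract\<close> applies again.\<close>
  have z: "B z (P (x \<cdot> a)) = B (- w) a" for a
    unfolding w_def by (simp add: form_P form_left linear_simps)
  have "(\<Sum>(a, b)\<leftarrow>xs. \<Sum>(a', b')\<leftarrow>xs. B x (a \<cdot> a' - a' \<cdot> a) * B y b * B z b') =
      (\<Sum>(a, b)\<leftarrow>xs. B y b * (\<Sum>(a', b')\<leftarrow>xs. B (x \<cdot> a) a' * B z b'))"
    unfolding form_ad by (simp add: expand_sum mult.left_commute)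
  also have "\<dots> = (\<Sum>(a, b)\<leftarrow>xs. B y b * B (- w) a)"
    unfolding contr z ..
  also have "\<dots> = (\<Sum>(a, b)\<leftarrow>xs. B (- w) a * B y b)"
    by (simp only: mult.commute)
  also have "\<dots> = B y (P (- w))" unfolding contr ..
  also have "\<dots> = - B w (P y + s lam y)"
    using form_P[of y w] form_skew[of w] by (simp add: linear_simps)
  also have "\<dots> = - B (P z + s lam z) (x \<cdot> (P y + s lam y))"
    by (simp add: w_def form_left)
  also have "\<dots> = B z (P (x \<cdot> (P y + s lam y)))"
    using form_P[of z "x \<cdot> (P y + s lam y)"] by (simp add: linearD(1,2)[OF linear_form(2)])
  finally have 3: "(\<Sum>(a, b)\<leftarrow>xs. \<Sum>(a', b')\<leftarrow>xs. B x (a \<cdot> a' - a' \<cdot> a) * B y b * B z b') =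
      B z (P (x \<cdot> (P y + s lam y)))" .
  have "perm_YB_sum s m xs (sharp B x) (sharp B y) (sharp B z) =
      (\<Sum>(a, b)\<leftarrow>xs. \<Sum>(a', b')\<leftarrow>xs. B x a * B y (b \<cdot> a') * B z b')
      - (\<Sum>(a, b)\<leftarrow>xs. \<Sum>(a', b')\<leftarrow>xs. B x a * B y a' * B z (b \<cdot> b'))
      + (\<Sum>(a, b)\<leftarrow>xs. \<Sum>(a', b')\<leftarrow>xs. B x (a \<cdot> a' - a' \<cdot> a) * B y b * B z b')"
    unfolding perm_YB_sum_def fun_sum_list case_prod_beta
    by (simp add: pure3_def sharp_dual sum_list_addf sum_list_subtractf linear_simps algebra_simps)
      (simp add: sharp_apply algebra_simps)
  \<comment> \<open>The three values combine to \<open>B z\<close> of the difference of the two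
    sides of the Rota-Baxter identity.\<close>
  also have "\<dots> = 0"
    unfolding 1 2 3 rota_baxter by (simp add: linear_simps)
  finally show "perm_YB_sum s m xs (sharp B x) (sharp B y) (sharp B z) =
      0 (sharp B x) (sharp B y) (sharp B z)" by simp
qed

section \<open>The skew part of \<open>r\<close> and factorizability\<close>

lemma skew_part_sharp: "(r - tflip r) (sharp B x) (sharp B y) = lam * B x y"
  by (simp add: tflip_def r_sharp form_P_swap[of y x] linear_simps)

text \<open>On a multiple of \<open>B\<close>, invariance says exactly that \<open>R(a)\<close> and
  \<open>ad(a)\<close> are adjoint.\<close>

lemma R_ad_invariant_skew_part: "R_ad_invariant s m (tscale c (r - tflip r))"
proof -
  define k where "k = tscale c (r - tflip r)"
  have k: "supported2 k"
    by (simp only: k_def supported2_simps supported2_r)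
  have k_sharp: "k (sharp B x) (sharp B y) = c * lam * B x y" for x y
    unfolding k_def tscale_def skew_part_sharp by simp
  have "R_ad_map s m a k = 0" for a
    by (rule tensor2_eqI)
      (simp_all add: R_ad_map_def k k_sharp tensor_map_sharp sharp_comp form_ad)
  then show ?thesis by (simp add: R_ad_invariant_def k_def)
qed

text \<open>The sign comes from skew-symmetry: a test functional \<open>sharp B y\<close> has y on
  the left, whereas the skew part is \<open>lam * B x y\<close>.\<close>

lemma T_map_skew_part: "T_map s (r - tflip r) (sharp B x) = s (- lam) x"
  unfolding T_map_def
proof (rule the_equality)
  have *: "g (s (- lam) x) = (r - tflip r) (sharp B x) g" if "g \<in> dual s" for g
    using that
  proof (rule dual_eq_sharp)
    fix y assume g: "g = sharp B y"
    show ?thesis using form_skew[of x y]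
      unfolding g skew_part_sharp by (simp add: sharp_apply linear_simps)
  qed
  then show "\<forall>g\<in>dual s. g (s (- lam) x) = (r - tflip r) (sharp B x) g" by blast
  fix v assume "\<forall>g\<in>dual s. g v = (r - tflip r) (sharp B x) g"
  then show "v = s (- lam) x" using * by (intro dual_separates) metis
qed

lemma dual_linear_iso_skew_part:
  assumes "lam \<noteq> 0"
  shows "dual_linear_iso s (T_map s (r - tflip r))"
proof -
  have add: "(\<lambda>v. sharp B x v + sharp B y v) = sharp B (x + y)" for x y
    by (auto simp: sharp_apply linear_simps)
  have mult: "(\<lambda>v. c * sharp B x v) = sharp B (s c x)" for c x
    by (auto simp: sharp_apply linear_simps)
  have "dual_linear s (T_map s (r - tflip r))"
    unfolding dual_linear_def
    by (auto elim!: dual_eq_sharp simp: add mult T_map_skew_part scale_right_distrib mult.commute)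
  moreover have "bij_betw (T_map s (r - tflip r)) (dual s) UNIV"
    by (rule bij_betw_byWitness[where f' = "\<lambda>v. sharp B (s (- inverse lam) v)"])
      (use assms in \<open>auto elim!: dual_eq_sharp simp: T_map_skew_part sharp_dual\<close>)
  ultimately show ?thesis by (simp add: dual_linear_iso_def)
qed

end

theorem theorem5p6:
  fixes s :: "'k::field_char_0 \<Rightarrow> 'a::ab_group_add \<Rightarrow> 'a"
    and Basis :: "'a set"
    and m :: "'a \<Rightarrow> 'a \<Rightarrow> 'a"
    and B :: "'a \<Rightarrow> 'a \<Rightarrow> 'k"
    and P :: "'a \<Rightarrow> 'a"
    and lam :: 'k
    and r :: "('a, 'k) tensor2"
  assumes "finite_dimensional_vector_space s Basis"
    and "quadratic_rota_baxter_perm_algebra s m B P lam"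
    and "lam \<noteq> 0"
    and "r \<in> tensors2 s"
    and "\<forall>f \<in> dual s. T_map s r f = P (inv (sharp B) f)"
  shows "factorizable_perm_bialgebra s m r"
proof -
  interpret finite_dimensional_vector_space s Basis by fact
  interpret rota_baxter_tensor s Basis m B P lam r
    by unfold_locales (use assms in auto)
  show ?thesis
    unfolding factorizable_perm_bialgebra_def quasi_triangular_perm_bialgebra_def perm_YBE_def
    using perm_bialgebra_Delta r_tensor perm_YB_sum_r R_ad_invariant_skew_part
      dual_linear_iso_skew_part[OF assms(3)] by blast
qed

end
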